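(* Let $\Gamma$ be a group and let $\mu:2^{\Gamma}\to[0,1]$ be a symmetric polymatroidal function over $\Gamma$ taking values in $[0,1]$. Let $(G=(V,E),\psi)$ be a finite $\Gamma$-gain graph. Define $g_\mu:2^E\to\mathbb{R}$ by $$g_\mu(F)=|V(F)|-c(F)+\sum_{X\in C(F)}\mu\langle X\rangle\qquad(F\subseteq E).$$ Then $g_\mu$ is monotone (i.e. $g_\mu(X)\le g_\mu(Y)$ whenever $X\subseteq Y\subseteq E$) and submodular (i.e. $g_\mu(X)+g_\mu(Y)\ge g_\mu(X\cup Y)+g_\mu(X\cap Y)$ for all $X,Y\subseteq E$).
   Context: A $\Gamma$-gain graph $(G,\psi)$ consists of a finite directed graph $G=(V,E)$ (loops and multiple edges allowed) and a map $\psi:E\to\Gamma$; reversing the orientation of an edge replaces its gain $g$ by $g^{-1}$. For a walk $v_0,e_1,v_1,\dots,e_k,v_k$ its gain is $\psi(e_1)^{\pm1}\cdots\psi(e_k)^{\pm1}$, with exponent $+1$ if $e_i$ is traversed in its forward direction and $-1$ otherwise. For $X\subseteq E$ and $v\in V$, $\langle X\rangle_{\psi,v}$ is the set of gains of closed walks starting and ending at $v$ using only edges of $X$ (a subgroup of $\Gamma$). For $F\subseteq E$: $V(F)$ is the set of endvertices of edges of $F$; $C(F)$ is the partition of $F$ into the edge sets of the connected components of the graph $(V(F),F)$, and $c(F)=|C(F)|$. A function $\mu:2^\Gamma\to\mathbb{R}_{\ge 0}$ is a symmetric polymatroidal function over $\Gamma$ if: $\mu(\emptyset)=0$; $\mu(X)\le\mu(Y)$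 for $X\subseteq Y\subseteq\Gamma$; $\mu(X)+\mu(Y)\ge\mu(X\cup Y)+\mu(X\cap Y)$ for all $X,Y\subseteq\Gamma$; $\mu(X)=\mu(\langle X\rangle)$ for every nonempty $X\subseteq\Gamma$, where $\langle X\rangle$ is the subgroup generated by $X$; and $\mu(X)=\mu(\gamma X\gamma^{-1})$ for every nonempty $X\subseteq\Gamma$ and $\gamma\in\Gamma$. For connected $X\subseteq E$ (i.e. $(V(X),X)$ connected), $\mu\langle X\rangle$ denotes $\mu(\langle X\rangle_{\psi,v})$ for any $v\in V(X)$; this does not depend on the choice of $v$. *)

theory Defs
  imports
    "HOL-Algebra.Generated_Groups"
    "Graph_Theory.Digraph_Component"
begin

text \<open>
  A symmetric polymatroidal function is only constrained on subsets of the carrier.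
\<close>

locale symmetric_polymatroidal = group \<Gamma>
  for \<Gamma> :: "('g, 'm) monoid_scheme" (structure) +
  fixes \<mu> :: "'g set \<Rightarrow> real"
  assumes nonneg: "X \<subseteq> carrier \<Gamma> \<Longrightarrow> 0 \<le> \<mu> X"
    and empty: "\<mu> {} = 0"
    and monotone: "\<lbrakk>X \<subseteq> Y; Y \<subseteq> carrier \<Gamma>\<rbrakk> \<Longrightarrow> \<mu> X \<le> \<mu> Y"
    and submodular: "\<lbrakk>X \<subseteq> carrier \<Gamma>; Y \<subseteq> carrier \<Gamma>\<rbrakk>
      \<Longrightarrow> \<mu> (X \<union> Y) + \<mu> (X \<inter> Y) \<le> \<mu> X + \<mu> Y"
    and generate_eq: "\<lbrakk>X \<subseteq> carrier \<Gamma>; X \<noteq> {}\<rbrakk> \<Longrightarrow> \<mu> X = \<mu> (generate \<Gamma> X)"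
    and conjugate_eq: "\<lbrakk>X \<subseteq> carrier \<Gamma>; X \<noteq> {}; \<gamma> \<in> carrier \<Gamma>\<rbrakk>
      \<Longrightarrow> \<mu> X = \<mu> (\<gamma> <# X #> inv \<gamma>)"

locale gain_graph = group \<Gamma> + fin_digraph G
  for \<Gamma> :: "('g, 'm) monoid_scheme"
    and G :: "('a, 'b) pre_digraph" +
  fixes \<psi> :: "'b \<Rightarrow> 'g"
  assumes gain_in_carrier: "e \<in> arcs G \<Longrightarrow> \<psi> e \<in> carrier \<Gamma>"

text \<open>
  The walks of Graph_Theory follow the orientation of the arcs. Here a step of a walk is a pair
  of an arc and a flag telling whether the arc is traversed forwards, from its tail to its head.
\<close>

type_synonym 'b step = "'b \<times> bool"

definition step_source :: "('a, 'b) pre_digraph \<Rightarrow> 'b step \<Rightarrow> 'a" where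
  "step_source G s = (if snd s then tail G (fst s) else head G (fst s))"

definition step_target :: "('a, 'b) pre_digraph \<Rightarrow> 'b step \<Rightarrow> 'a" where
  "step_target G s = (if snd s then head G (fst s) else tail G (fst s))"

primrec walk_in :: "('a, 'b) pre_digraph \<Rightarrow> 'b set \<Rightarrow> 'a \<Rightarrow> 'b step list \<Rightarrow> 'a \<Rightarrow> bool" where
  "walk_in G X u [] v \<longleftrightarrow> u = v"
| "walk_in G X u (s # p) v \<longleftrightarrow>
     fst s \<in> X \<and> step_source G s = u \<and> walk_in G X (step_target G s) p v"

primrec walk_gain :: "('g, 'm) monoid_scheme \<Rightarrow> ('b \<Rightarrow> 'g) \<Rightarrow> 'b step list \<Rightarrow> 'g" where
  "walk_gain \<Gamma> \<psi> [] = \<one>\<^bsub>\<Gamma>\<^esub>"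
| "walk_gain \<Gamma> \<psi> (s # p) =
     (if snd s then \<psi> (fst s) else inv\<^bsub>\<Gamma>\<^esub> \<psi> (fst s)) \<otimes>\<^bsub>\<Gamma>\<^esub> walk_gain \<Gamma> \<psi> p"

definition gain_group ::
  "('g, 'm) monoid_scheme \<Rightarrow> ('a, 'b) pre_digraph \<Rightarrow> ('b \<Rightarrow> 'g) \<Rightarrow> 'b set \<Rightarrow> 'a \<Rightarrow> 'g set" where
  "gain_group \<Gamma> G \<psi> X v = {walk_gain \<Gamma> \<psi> p |p. walk_in G X v p v}"

definition endverts :: "('a, 'b) pre_digraph \<Rightarrow> 'b set \<Rightarrow> 'a set" where
  "endverts G F = tail G ` F \<union> head G ` F"

definition edge_subgraph :: "('a, 'b) pre_digraph \<Rightarrow> 'b set \<Rightarrow> ('a, 'b) pre_digraph" where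
  "edge_subgraph G F = G\<lparr>verts := endverts G F, arcs := F\<rparr>"

text \<open>
  The predicate connected of Graph_Theory is connectedness of the underlying undirected graph,
  and it excludes the graph without vertices.
\<close>

definition edge_components :: "('a, 'b) pre_digraph \<Rightarrow> 'b set \<Rightarrow> 'b set set" where
  "edge_components G F =
     arcs ` {H. pre_digraph.max_subgraph (edge_subgraph G F) connected H}"

text \<open>
  By lemma \<open>connected_gain_value_eq\<close> below, the choice of the base vertex does not matter
  when the edge set is connected.
\<close>

definition connected_gain_value ::
  "('g, 'm) monoid_scheme \<Rightarrow> ('g set \<Rightarrow> real) \<Rightarrow> ('a, 'b) pre_digraph \<Rightarrow> ('b \<Rightarrow> 'g)
     \<Rightarrow> 'b set \<Rightarrow> real" where
  "connected_gain_value \<Gamma> \<mu> G \<psi> X = \<mu> (gain_group \<Gamma> G \<psi> X (SOME v. v \<in> endverts G X))"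

definition gain_rank ::
  "('g, 'm) monoid_scheme \<Rightarrow> ('g set \<Rightarrow> real) \<Rightarrow> ('a, 'b) pre_digraph \<Rightarrow> ('b \<Rightarrow> 'g)
     \<Rightarrow> 'b set \<Rightarrow> real" where
  "gain_rank \<Gamma> \<mu> G \<psi> F =
     real (card (endverts G F)) - real (card (edge_components G F))
       + (\<Sum>X\<in>edge_components G F. connected_gain_value \<Gamma> \<mu> G \<psi> X)"


lemma walk_in_append:
  "walk_in G X u (p @ q) w \<longleftrightarrow> (\<exists>v. walk_in G X u p v \<and> walk_in G X v q w)"
  by (induction p arbitrary: u) auto

definition rev_walk :: "'b step list \<Rightarrow> 'b step list" where
  "rev_walk p = rev (map (\<lambda>s. (fst s, \<not> snd s)) p)"

lemma walk_in_rev: "walk_in G X u p v \<Longrightarrow> walk_in G X v (rev_walk p) u"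
  by (induction p arbitrary: u)
    (auto simp: rev_walk_def walk_in_append step_source_def step_target_def)

lemma walk_in_arcs: "walk_in G X u p v \<Longrightarrow> fst ` set p \<subseteq> X"
  by (induction p arbitrary: u) auto

context gain_graph
begin

lemma walk_gain_closed: "fst ` set p \<subseteq> arcs G \<Longrightarrow> walk_gain \<Gamma> \<psi> p \<in> carrier \<Gamma>"
  by (induction p) (auto simp: gain_in_carrier)

lemma walk_gain_append:
  "\<lbrakk>fst ` set p \<subseteq> arcs G; fst ` set q \<subseteq> arcs G\<rbrakk>
    \<Longrightarrow> walk_gain \<Gamma> \<psi> (p @ q) = walk_gain \<Gamma> \<psi> p \<otimes>\<^bsub>\<Gamma>\<^esub> walk_gain \<Gamma> \<psi> q"
  by (induction p) (auto simp: gain_in_carrier walk_gain_closed m_assoc)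

lemma walk_gain_rev:
  "fst ` set p \<subseteq> arcs G \<Longrightarrow> walk_gain \<Gamma> \<psi> (rev_walk p) = inv\<^bsub>\<Gamma>\<^esub> walk_gain \<Gamma> \<psi> p"
proof (induction p)
  case Nil
  then show ?case by (simp add: rev_walk_def)
next
  case (Cons s p)
  have eq: "rev_walk (s # p) = rev_walk p @ [(fst s, \<not> snd s)]"
    by (simp add: rev_walk_def)
  have p: "fst ` set (rev_walk p) \<subseteq> arcs G"
    using Cons.prems by (auto simp: rev_walk_def)
  show ?case
    unfolding eq using Cons p
    by (subst walk_gain_append) (auto simp: gain_in_carrier walk_gain_closed inv_mult_group)
qed

lemma gain_group_subgroup:
  assumes X: "X \<subseteq> arcs G"
  shows "subgroup (gain_group \<Gamma> G \<psi> X v) \<Gamma>"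
proof (rule subgroupI)
  note sub = order_trans[OF walk_in_arcs X]
  show "gain_group \<Gamma> G \<psi> X v \<subseteq> carrier \<Gamma>"
    by (auto simp: gain_group_def intro!: walk_gain_closed dest!: sub)
  have "walk_gain \<Gamma> \<psi> [] \<in> gain_group \<Gamma> G \<psi> X v"
    unfolding gain_group_def by (rule CollectI) (intro exI[of _ "[]"], simp)
  then show "gain_group \<Gamma> G \<psi> X v \<noteq> {}" by auto
  fix a assume "a \<in> gain_group \<Gamma> G \<psi> X v"
  then obtain p where p: "a = walk_gain \<Gamma> \<psi> p" "walk_in G X v p v"
    by (auto simp: gain_group_def)
  show "inv\<^bsub>\<Gamma>\<^esub> a \<in> gain_group \<Gamma> G \<psi> X v"
    using walk_gain_rev[OF sub[OF p(2)]] walk_in_rev[OF p(2)] p(1)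
    by (auto simp: gain_group_def intro!: exI[of _ "rev_walk p"])
  fix b assume "b \<in> gain_group \<Gamma> G \<psi> X v"
  then obtain q where q: "b = walk_gain \<Gamma> \<psi> q" "walk_in G X v q v"
    by (auto simp: gain_group_def)
  show "a \<otimes>\<^bsub>\<Gamma>\<^esub> b \<in> gain_group \<Gamma> G \<psi> X v"
    using walk_gain_append[OF sub[OF p(2)] sub[OF q(2)]] p q
    by (auto simp: gain_group_def walk_in_append intro!: exI[of _ "p @ q"])
qed

lemma gain_group_conjugate:
  assumes X: "X \<subseteq> arcs G" and w: "walk_in G X u w v"
  shows "gain_group \<Gamma> G \<psi> X u
    = walk_gain \<Gamma> \<psi> w <#\<^bsub>\<Gamma>\<^esub> gain_group \<Gamma> G \<psi> X v #>\<^bsub>\<Gamma>\<^esub> inv\<^bsub>\<Gamma>\<^esub> walk_gain \<Gamma> \<psi> w"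
    (is "_ = ?g <#\<^bsub>\<Gamma>\<^esub> _ #>\<^bsub>\<Gamma>\<^esub> _")
proof -
  note sub = order_trans[OF walk_in_arcs X]
  have g: "?g \<in> carrier \<Gamma>" by (rule walk_gain_closed[OF sub[OF w]])
  have conj: "x \<in> gain_group \<Gamma> G \<psi> X v \<Longrightarrow>
      walk_gain \<Gamma> \<psi> p \<otimes>\<^bsub>\<Gamma>\<^esub> x \<otimes>\<^bsub>\<Gamma>\<^esub> inv\<^bsub>\<Gamma>\<^esub> walk_gain \<Gamma> \<psi> p \<in> gain_group \<Gamma> G \<psi> X u"
    if p: "walk_in G X u p v" for p x u v
  proof -
    assume "x \<in> gain_group \<Gamma> G \<psi> X v"
    then obtain q where q: "x = walk_gain \<Gamma> \<psi> q" "walk_in G X v q v"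
      by (auto simp: gain_group_def)
    note r = walk_in_rev[OF p]
    have pq: "walk_in G X u (p @ q) v" using p q by (auto simp: walk_in_append)
    have "walk_in G X u ((p @ q) @ rev_walk p) u"
      unfolding walk_in_append[of _ _ _ "p @ q"] using pq r by blast
    moreover have "walk_gain \<Gamma> \<psi> ((p @ q) @ rev_walk p)
        = walk_gain \<Gamma> \<psi> p \<otimes>\<^bsub>\<Gamma>\<^esub> x \<otimes>\<^bsub>\<Gamma>\<^esub> inv\<^bsub>\<Gamma>\<^esub> walk_gain \<Gamma> \<psi> p"
      by (simp only: walk_gain_append[OF sub[OF pq] sub[OF r]]
          walk_gain_append[OF sub[OF p] sub[OF q(2)]] walk_gain_rev[OF sub[OF p]] q(1))
    ultimately show ?thesis unfolding gain_group_def by (metis (mono_tags, lifting) CollectI)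
  qed
  show ?thesis
  proof (intro equalityI subsetI)
    fix x assume x: "x \<in> gain_group \<Gamma> G \<psi> X u"
    then have xc: "x \<in> carrier \<Gamma>"
      using subgroup.mem_carrier[OF gain_group_subgroup[OF X]] by blast
    let ?y = "inv\<^bsub>\<Gamma>\<^esub> ?g \<otimes>\<^bsub>\<Gamma>\<^esub> x \<otimes>\<^bsub>\<Gamma>\<^esub> ?g"
    have y: "?y \<in> gain_group \<Gamma> G \<psi> X v"
      using conj[OF walk_in_rev[OF w] x] walk_gain_rev[OF sub[OF w]] g by simp
    have "x = ?g \<otimes>\<^bsub>\<Gamma>\<^esub> ?y \<otimes>\<^bsub>\<Gamma>\<^esub> inv\<^bsub>\<Gamma>\<^esub> ?g"
      using g xc by (simp add: m_assoc) (simp flip: m_assoc)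
    then show "x \<in> ?g <#\<^bsub>\<Gamma>\<^esub> gain_group \<Gamma> G \<psi> X v #>\<^bsub>\<Gamma>\<^esub> inv\<^bsub>\<Gamma>\<^esub> ?g"
      using y unfolding l_coset_def r_coset_def by blast
  next
    fix x assume "x \<in> ?g <#\<^bsub>\<Gamma>\<^esub> gain_group \<Gamma> G \<psi> X v #>\<^bsub>\<Gamma>\<^esub> inv\<^bsub>\<Gamma>\<^esub> ?g"
    then show "x \<in> gain_group \<Gamma> G \<psi> X u"
      using conj[OF w] unfolding l_coset_def r_coset_def by blast
  qed
qed

end

lemma reachable_walk_in:
  assumes "u \<rightarrow>\<^sup>*\<^bsub>mk_symmetric (edge_subgraph G X)\<^esub> v"
  shows "\<exists>p. walk_in G X u p v"
  using assms unfolding reachable_def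
proof (induction rule: rtrancl_on.induct)
  case (rtrancl_on_refl a)
  show ?case by (intro exI[of _ "[]"]) simp
next
  case (rtrancl_on_into_rtrancl_on a b c)
  then obtain p where p: "walk_in G X a p b" by blast
  from rtrancl_on_into_rtrancl_on(2) obtain e
    where e: "e \<in> X" "(b, c) = (tail G e, head G e) \<or> (b, c) = (head G e, tail G e)"
    by (auto simp: parcs_mk_symmetric edge_subgraph_def)
  then obtain s where s: "fst s \<in> X" "step_source G s = b" "step_target G s = c"
    using that[of "(e, True)"] that[of "(e, False)"]
    by (auto simp: step_source_def step_target_def)
  from p s have "walk_in G X a (p @ [s]) c" by (auto simp: walk_in_append)
  then show ?case by blast
qed

lemma connected_gain_value_eq:
  assumes "symmetric_polymatroidal \<Gamma> \<mu>" "gain_graph \<Gamma> G \<psi>"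
    and X: "X \<subseteq> arcs G" and con: "connected (edge_subgraph G X)" and v: "v \<in> endverts G X"
  shows "connected_gain_value \<Gamma> \<mu> G \<psi> X = \<mu> (gain_group \<Gamma> G \<psi> X v)"
proof -
  interpret symmetric_polymatroidal \<Gamma> \<mu> by fact
  interpret gg: gain_graph \<Gamma> G \<psi> by fact
  let ?u = "SOME v. v \<in> endverts G X"
  have "?u \<in> endverts G X" using v by (rule someI)
  then have reach: "?u \<rightarrow>\<^sup>*\<^bsub>mk_symmetric (edge_subgraph G X)\<^esub> v"
    using con v unfolding connected_def strongly_connected_def
    by (auto simp: edge_subgraph_def)
  obtain w where w: "walk_in G X ?u w v" using reachable_walk_in[OF reach] by blast
  note sg = gg.gain_group_subgroup[OF X, of v]
  show ?thesis
    unfolding connected_gain_value_def gg.gain_group_conjugate[OF X w]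
    using subgroup.subset[OF sg] subgroup.one_closed[OF sg]
      gg.walk_gain_closed[OF order_trans[OF walk_in_arcs[OF w] X]]
    by (intro conjugate_eq[symmetric]) auto
qed

end

theory Submission
  imports Defs
begin

text \<open>
  Let the gains at a vertex be the gain group there, or the empty set if the vertex is isolated.
  Counting isolated vertices as components with value \<open>\<mu> {} = 0\<close>, the rank of \<open>F\<close> is the number of
  all vertices minus the sum of \<open>1 - \<mu> A\<close> over the components, where \<open>A\<close> denotes the gains.
  Adding an arc inside a component replaces \<open>A\<close> by the group generated by \<open>A\<close> and one further
  element, so the rank grows by \<open>\<mu> (A \<union> {\<gamma>}) - \<mu> A\<close>. Adding an arc between components with gains
  \<open>A\<close> and \<open>B\<close> makes the rank grow by \<open>1 - \<mu> A - \<mu> B + \<mu> (A \<union> B \<union> {1})\<close>, after conjugating \<open>B\<close> to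
  the base point of \<open>A\<close>. Both are nonnegative, and submodularity of \<open>\<mu>\<close> and \<open>\<mu> \<le> 1\<close> make them
  antitone in \<open>F\<close>.
\<close>

section \<open>Vertex components\<close>

text \<open>An isolated vertex forms a component of its own here, unlike in
  \<open>edge_components\<close>. Walks take the place of library reachability because gains are
  read off them.\<close>

definition vertex_component :: "('a, 'b) pre_digraph \<Rightarrow> 'b set \<Rightarrow> 'a \<Rightarrow> 'a set" where
  "vertex_component G F v = {w. \<exists>p. walk_in G F v p w}"

text \<open>The set \<open>K\<close> is invariant under the steps available from it, so a walk
  starting in \<open>K\<close> never leaves it and meets only arcs of \<open>Y\<close>.\<close>

lemma walk_in_restrict:
  assumes "\<And>s. fst s \<in> X \<Longrightarrow> step_source G s \<in> K \<Longrightarrow> fst s \<in> Y \<and> step_target G s \<in> K"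
    and "walk_in G X u p v" "u \<in> K"
  shows "walk_in G Y u p v \<and> v \<in> K"
  using assms(2,3)
proof (induction p arbitrary: u)
  case (Cons s p)
  then show ?case using assms(1)[of s] by auto
qed auto

lemma walk_in_mono: "\<lbrakk>walk_in G X u p v; X \<subseteq> Y\<rbrakk> \<Longrightarrow> walk_in G Y u p v"
  by (induction p arbitrary: u) auto

lemma walk_in_tail_head: "a \<in> F \<Longrightarrow> walk_in G F (tail G a) [(a, True)] (head G a)"
  by (simp add: step_source_def step_target_def)

lemma walk_in_endverts: "\<lbrakk>walk_in G F u p v; p \<noteq> []\<rbrakk> \<Longrightarrow> u \<in> endverts G F \<and> v \<in> endverts G F"
proof (induction p arbitrary: u)
  case (Cons s p)
  then show ?case
    by (cases p) (auto simp: endverts_def step_source_def step_target_def)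
qed simp

section \<open>Components as classes of an equivalence relation\<close>

lemma vertex_component_refl: "v \<in> vertex_component G F v"
  unfolding vertex_component_def by (auto intro: exI[of _ "[]"])

lemma vertex_component_sym:
  "w \<in> vertex_component G F v \<Longrightarrow> v \<in> vertex_component G F w"
  unfolding vertex_component_def by (blast intro: walk_in_rev)

lemma vertex_component_trans:
  "\<lbrakk>w \<in> vertex_component G F v; x \<in> vertex_component G F w\<rbrakk> \<Longrightarrow> x \<in> vertex_component G F v"
  unfolding vertex_component_def mem_Collect_eq by (metis walk_in_append)

lemma vertex_component_eq:
  "w \<in> vertex_component G F v \<Longrightarrow> vertex_component G F w = vertex_component G F v"
  by (blast intro: vertex_component_sym vertex_component_trans)

lemma vertex_component_mono:
  "X \<subseteq> Y \<Longrightarrow> vertex_component G X v \<subseteq> vertex_component G Y v"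
  unfolding vertex_component_def by (auto intro: walk_in_mono)

lemma head_in_vertex_component: "a \<in> F \<Longrightarrow> head G a \<in> vertex_component G F (tail G a)"
  unfolding vertex_component_def by (blast intro: walk_in_tail_head)

lemma tail_in_vertex_component_iff:
  "a \<in> F \<Longrightarrow> tail G a \<in> vertex_component G F v \<longleftrightarrow> head G a \<in> vertex_component G F v"
  by (meson head_in_vertex_component vertex_component_sym vertex_component_trans)

lemma vertex_component_step:
  "\<lbrakk>fst s \<in> F; step_source G s \<in> vertex_component G F v\<rbrakk>
    \<Longrightarrow> step_target G s \<in> vertex_component G F v"
  by (auto simp: step_source_def step_target_def tail_in_vertex_component_iff split: if_splits)

lemma vertex_component_isolated:
  "v \<notin> endverts G F \<Longrightarrow> vertex_component G F v = {v}"
proof -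
  assume "v \<notin> endverts G F"
  then have "p = []" if "walk_in G F v p w" for p w using walk_in_endverts[OF that] by blast
  then show ?thesis
    using vertex_component_refl[of v G F] unfolding vertex_component_def by fastforce
qed

lemma vertex_component_endverts:
  assumes "w \<in> vertex_component G F v" shows "w \<in> endverts G F \<longleftrightarrow> v \<in> endverts G F"
proof -
  obtain p where "walk_in G F v p w" using assms by (auto simp: vertex_component_def)
  then show ?thesis by (cases "p = []") (auto dest: walk_in_endverts)
qed

section \<open>Components after the insertion of an arc\<close>

lemma walk_in_insert_other:
  assumes "x \<notin> vertex_component G F (tail G e)" "x \<notin> vertex_component G F (head G e)"
  shows "walk_in G (insert e F) x p y \<longleftrightarrow> walk_in G F x p y"
proof
  assume p: "walk_in G (insert e F) x p y"
  have "fst s \<in> F \<and> step_target G s \<in> vertex_component G F x"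
    if "fst s \<in> insert e F" "step_source G s \<in> vertex_component G F x" for s
  proof -
    \<comment> \<open>A step along \<open>e\<close> would place an end of \<open>e\<close> in the
      component of \<open>x\<close>, and by symmetry \<open>x\<close> in the component of that
      end.\<close>
    have "fst s \<noteq> e"
      using that(2) assms
      by (auto simp: step_source_def dest: vertex_component_sym split: if_splits)
    then show ?thesis using that vertex_component_step[of s F G x] by auto
  qed
  from walk_in_restrict[OF this p vertex_component_refl] show "walk_in G F x p y" by blast
qed (auto intro: walk_in_mono)

text \<open>The set \<open>M\<close> covers both situations: it is a single component if the ends of
  \<open>e\<close> were already joined, and the merger of two components otherwise.\<close>

lemma vertex_component_insert:
  fixes G e F
  defines "M \<equiv> vertex_component G F (tail G e) \<union> vertex_component G F (head G e)"
  shows "vertex_component G (insert e F) x = (if x \<in> M then M else vertex_component G F x)"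
proof -
  have sub: "vertex_component G F y \<subseteq> vertex_component G (insert e F) y" for y
    by (rule vertex_component_mono) blast
  have *: "vertex_component G (insert e F) x \<subseteq> M" if "x \<in> M" for x
  proof
    fix y assume "y \<in> vertex_component G (insert e F) x"
    then obtain p where p: "walk_in G (insert e F) x p y" by (auto simp: vertex_component_def)
    have "fst s \<in> insert e F \<and> step_target G s \<in> M"
      if "fst s \<in> insert e F" "step_source G s \<in> M" for s
      using that vertex_component_step[of s F G] vertex_component_refl[of _ G F]
      unfolding M_def by (auto simp: step_target_def)
    from walk_in_restrict[OF this p \<open>x \<in> M\<close>] show "y \<in> M" by blast
  qed
  have tM: "M \<subseteq> vertex_component G (insert e F) (tail G e)"
    unfolding M_def
    using sub[of "tail G e"] sub[of "head G e"]
      vertex_component_eq[OF head_in_vertex_component[of e "insert e F" G]] by simp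
  show ?thesis
  proof (cases "x \<in> M")
    case True
    then have "vertex_component G (insert e F) x = vertex_component G (insert e F) (tail G e)"
      using tM by (intro vertex_component_eq) auto
    then show ?thesis using *[OF True] tM True by auto
  next
    case False
    then show ?thesis
      using walk_in_insert_other[of x G F e]
      by (simp add: M_def vertex_component_def[of _ _ x])
  qed
qed

section \<open>Edge components\<close>

text \<open>Converse of \<open>reachable_walk_in\<close>. The start has to be an end vertex because
  even the empty path needs its vertex in the subgraph.\<close>

lemma walk_in_reachable:
  assumes "walk_in G X u p v" "u \<in> endverts G X"
  shows "u \<rightarrow>\<^sup>*\<^bsub>mk_symmetric (edge_subgraph G X)\<^esub> v"
  using assms
proof (induction p arbitrary: u)
  case Nil
  then show ?case by (auto simp: reachable_def edge_subgraph_def)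
next
  case (Cons s p)
  let ?w = "step_target G s"
  have w: "?w \<in> endverts G X" using Cons.prems(1)
    by (auto simp: endverts_def step_target_def)
  have "(u, ?w) \<in> parcs (mk_symmetric (edge_subgraph G X))"
    using Cons.prems(1)
    by (auto simp: parcs_mk_symmetric edge_subgraph_def step_source_def step_target_def
        intro!: bexI[of _ "fst s"])
  then show ?case
    using Cons.IH[of ?w] Cons.prems w unfolding reachable_def
    by (intro converse_rtrancl_on_into_rtrancl_on[of u ?w]) (auto simp: edge_subgraph_def)
qed

text \<open>Testing the tail is enough because both ends of an arc of \<open>F\<close> lie in the
  same component.\<close>

definition component_arcs :: "('a, 'b) pre_digraph \<Rightarrow> 'b set \<Rightarrow> 'a \<Rightarrow> 'b set" where
  "component_arcs G F v = {a \<in> F. tail G a \<in> vertex_component G F v}"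

lemma endverts_component_arcs:
  assumes "v \<in> endverts G F"
  shows "endverts G (component_arcs G F v) = vertex_component G F v"
proof
  show "endverts G (component_arcs G F v) \<subseteq> vertex_component G F v"
    by (auto simp: endverts_def component_arcs_def tail_in_vertex_component_iff)
  show "vertex_component G F v \<subseteq> endverts G (component_arcs G F v)"
  proof
    fix w assume w: "w \<in> vertex_component G F v"
    then have "w \<in> endverts G F" using assms vertex_component_endverts by metis
    then obtain a where "a \<in> F" "w = tail G a \<or> w = head G a" by (auto simp: endverts_def)
    then show "w \<in> endverts G (component_arcs G F v)"
      using w by (auto simp: endverts_def component_arcs_def tail_in_vertex_component_iff)
  qed
qed

text \<open>Walks from \<open>v\<close> never leave its component. Hence the gain group at
  \<open>v\<close> can be computed in all of \<open>F\<close>.\<close>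

lemma walk_in_component_arcs:
  "walk_in G (component_arcs G F v) v p w \<longleftrightarrow> walk_in G F v p w"
proof
  assume p: "walk_in G F v p w"
  have "fst s \<in> component_arcs G F v \<and> step_target G s \<in> vertex_component G F v"
    if "fst s \<in> F" "step_source G s \<in> vertex_component G F v" for s
    using that by (auto simp: component_arcs_def step_source_def step_target_def
        tail_in_vertex_component_iff split: if_splits)
  from walk_in_restrict[OF this p vertex_component_refl]
  show "walk_in G (component_arcs G F v) v p w" by blast
qed (auto intro: walk_in_mono simp: component_arcs_def)

lemma connected_component_arcs:
  assumes v: "v \<in> endverts G F"
  shows "connected (edge_subgraph G (component_arcs G F v))"
  unfolding connected_def
proof (rule strongly_connectedI)
  let ?X = "component_arcs G F v"
  show "verts (with_proj (mk_symmetric (edge_subgraph G ?X))) \<noteq> {}"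
    using vertex_component_refl[of v G F]
    by (auto simp: edge_subgraph_def endverts_component_arcs[OF v])
  fix x y assume "x \<in> verts (with_proj (mk_symmetric (edge_subgraph G ?X)))"
    "y \<in> verts (with_proj (mk_symmetric (edge_subgraph G ?X)))"
  then have x: "x \<in> endverts G ?X" "x \<in> vertex_component G F v" "y \<in> vertex_component G F v"
    by (auto simp: edge_subgraph_def endverts_component_arcs[OF v])
  then obtain p q where "walk_in G ?X v p x" "walk_in G ?X v q y"
    by (auto simp: vertex_component_def walk_in_component_arcs)
  \<comment> \<open>Any two vertices are joined through \<open>v\<close>: back along
    \<open>p\<close>, then on along \<open>q\<close>.\<close>
  then have "walk_in G ?X x (rev_walk p @ q) y"
    using walk_in_rev[of G ?X v p x] by (auto simp: walk_in_append)
  then show "x \<rightarrow>\<^sup>*\<^bsub>mk_symmetric (edge_subgraph G ?X)\<^esub> y"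
    using x(1) by (rule walk_in_reachable)
qed

section \<open>Components as maximal connected subgraphs\<close>

lemma subgraph_edge_subgraph:
  assumes "X \<subseteq> F"
  shows "subgraph (edge_subgraph G X) (edge_subgraph G F)"
  using assms
  by (intro subgraphI) (auto simp: edge_subgraph_def compatible_def endverts_def wf_digraph_def)

text \<open>Each vertex of \<open>H\<close> is reachable from \<open>v\<close> inside
  \<open>H\<close>, hence inside \<open>F\<close>, so the component of \<open>v\<close> absorbs all
  of \<open>H\<close>.\<close>

lemma connected_subgraph_component:
  assumes sub: "subgraph H (edge_subgraph G F)" and con: "connected H" and v: "v \<in> verts H"
  shows "subgraph H (edge_subgraph G (component_arcs G F v))"
proof -
  interpret H: wf_digraph H using sub by (rule subgraphE)
  have eq: "tail H = tail G" "head H = head G" and F: "arcs H \<subseteq> F" "verts H \<subseteq> endverts G F"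
    using sub by (auto simp: subgraph_def compatible_def edge_subgraph_def)
  have HC: "verts H \<subseteq> vertex_component G F v"
  proof
    fix w assume "w \<in> verts H"
    then have "v \<rightarrow>\<^sup>*\<^bsub>mk_symmetric H\<^esub> w"
      using con v unfolding connected_def strongly_connected_def by auto
    then have "v \<rightarrow>\<^sup>*\<^bsub>mk_symmetric (edge_subgraph G F)\<^esub> w"
      by (rule pre_digraph.reachable_mono[OF _ subgraph_mk_symmetric[OF sub]])
    then show "w \<in> vertex_component G F v"
      unfolding vertex_component_def by (auto dest: reachable_walk_in)
  qed
  have vF: "v \<in> endverts G F" using v F by auto
  show ?thesis
  proof (rule subgraphI)
    show "verts H \<subseteq> verts (edge_subgraph G (component_arcs G F v))"
      using HC by (simp add: edge_subgraph_def endverts_component_arcs[OF vF])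
    show "arcs H \<subseteq> arcs (edge_subgraph G (component_arcs G F v))"
      using HC F(1) H.tail_in_verts by (auto simp: edge_subgraph_def component_arcs_def eq)
    show "compatible (edge_subgraph G (component_arcs G F v)) H"
      by (simp add: edge_subgraph_def compatible_def eq)
    show "wf_digraph (edge_subgraph G (component_arcs G F v))"
      by (auto simp: edge_subgraph_def wf_digraph_def endverts_def)
  qed (rule H.wf_digraph_axioms)
qed

lemma subgraph_antisym: "\<lbrakk>subgraph H K; subgraph K H\<rbrakk> \<Longrightarrow> H = K"
  for H K :: "('a, 'b) pre_digraph"
  by (rule pre_digraph.equality) (auto simp: subgraph_def compatible_def)

text \<open>A component is connected and contains every connected subgraph through \<open>v\<close>.
  So it is maximal, and a maximal connected subgraph has to coincide with the component of any of
  its vertices.\<close>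

lemma max_connected_subgraph_iff:
  "pre_digraph.max_subgraph (edge_subgraph G F) connected H
    \<longleftrightarrow> (\<exists>v\<in>endverts G F. H = edge_subgraph G (component_arcs G F v))" (is "?L \<longleftrightarrow> ?R")
proof
  assume L: ?L
  then have H: "subgraph H (edge_subgraph G F)" "connected H"
    by (auto simp: pre_digraph.max_subgraph_def)
  then obtain v where v: "v \<in> verts H"
    unfolding connected_def strongly_connected_def by auto
  then have vF: "v \<in> endverts G F" using H(1) by (auto simp: subgraph_def edge_subgraph_def)
  let ?C = "edge_subgraph G (component_arcs G F v)"
  have "subgraph ?C (edge_subgraph G F)"
    by (rule subgraph_edge_subgraph) (auto simp: component_arcs_def)
  then have "H = ?C"
    using L connected_subgraph_component[OF H v] connected_component_arcs[OF vF]
    unfolding pre_digraph.max_subgraph_def by metis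
  with vF show ?R by blast
next
  assume ?R
  then obtain v where v: "v \<in> endverts G F" and H: "H = edge_subgraph G (component_arcs G F v)"
    by blast
  have "v \<in> verts H"
    by (simp add: H edge_subgraph_def endverts_component_arcs[OF v] vertex_component_refl)
  show ?L
  proof (rule pre_digraph.max_subgraphI)
    show "connected H" unfolding H by (rule connected_component_arcs[OF v])
    show "subgraph H (edge_subgraph G F)"
      unfolding H by (rule subgraph_edge_subgraph) (auto simp: component_arcs_def)
    fix H' assume H': "H \<noteq> H'" "subgraph H H'" "subgraph H' (edge_subgraph G F)"
    show "\<not> connected H'"
    proof
      assume "connected H'"
      moreover have "v \<in> verts H'"
        using H'(2) \<open>v \<in> verts H\<close> by (auto simp: subgraph_def)
      ultimately have "subgraph H' H"
        unfolding H by (rule connected_subgraph_component[OF H'(3)])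
      then show False using H'(1) subgraph_antisym[OF H'(2)] by simp
    qed
  qed
qed

lemma edge_components_eq: "edge_components G F = component_arcs G F ` endverts G F"
proof -
  have "{H. pre_digraph.max_subgraph (edge_subgraph G F) connected H}
      = (\<lambda>v. edge_subgraph G (component_arcs G F v)) ` endverts G F"
    unfolding max_connected_subgraph_iff by blast
  then show ?thesis
    by (simp add: edge_components_def image_image edge_subgraph_def)
qed

section \<open>Gains after the insertion of an arc\<close>

text \<open>At an isolated vertex the trivial subgroup would be the wrong choice:
  \<open>\<mu>\<close> may be positive on it, whereas a vertex without arcs contributes nothing to
  the rank.\<close>

definition local_gains ::
  "('g, 'm) monoid_scheme \<Rightarrow> ('a, 'b) pre_digraph \<Rightarrow> ('b \<Rightarrow> 'g) \<Rightarrow> 'b set \<Rightarrow> 'a \<Rightarrow> 'g set" where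
  "local_gains \<Gamma> G \<psi> F v = (if v \<in> endverts G F then gain_group \<Gamma> G \<psi> F v else {})"

context gain_graph
begin

section \<open>Gains of walks, gain groups and isolated vertices\<close>

lemma endverts_subset: "F \<subseteq> arcs G \<Longrightarrow> endverts G F \<subseteq> verts G"
  by (auto simp: endverts_def)

lemma walk_in_gain_closed: "\<lbrakk>walk_in G F u p v; F \<subseteq> arcs G\<rbrakk> \<Longrightarrow> walk_gain \<Gamma> \<psi> p \<in> carrier \<Gamma>"
  by (meson order_trans walk_gain_closed walk_in_arcs)

lemma walk_in_gain_append:
  "\<lbrakk>walk_in G F u p v; walk_in G F v q w; F \<subseteq> arcs G\<rbrakk>
    \<Longrightarrow> walk_gain \<Gamma> \<psi> (p @ q) = walk_gain \<Gamma> \<psi> p \<otimes>\<^bsub>\<Gamma>\<^esub> walk_gain \<Gamma> \<psi> q"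
  by (meson order_trans walk_gain_append walk_in_arcs)

lemma walk_in_gain_rev:
  "\<lbrakk>walk_in G F u p v; F \<subseteq> arcs G\<rbrakk> \<Longrightarrow> walk_gain \<Gamma> \<psi> (rev_walk p) = inv\<^bsub>\<Gamma>\<^esub> walk_gain \<Gamma> \<psi> p"
  by (meson order_trans walk_gain_rev walk_in_arcs)

lemma closed_walk_gain: "walk_in G F u p u \<Longrightarrow> walk_gain \<Gamma> \<psi> p \<in> gain_group \<Gamma> G \<psi> F u"
  by (auto simp: gain_group_def)

lemma gain_group_mono: "X \<subseteq> Y \<Longrightarrow> gain_group \<Gamma> G \<psi> X v \<subseteq> gain_group \<Gamma> G \<psi> Y v"
  by (auto simp: gain_group_def intro: walk_in_mono)

lemma one_in_gain_group: "F \<subseteq> arcs G \<Longrightarrow> \<one>\<^bsub>\<Gamma>\<^esub> \<in> gain_group \<Gamma> G \<psi> F v"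
  by (rule subgroup.one_closed[OF gain_group_subgroup])

lemma gain_group_closed: "F \<subseteq> arcs G \<Longrightarrow> gain_group \<Gamma> G \<psi> F v \<subseteq> carrier \<Gamma>"
  by (rule subgroup.subset[OF gain_group_subgroup])

lemma local_gains_closed: "F \<subseteq> arcs G \<Longrightarrow> local_gains \<Gamma> G \<psi> F v \<subseteq> carrier \<Gamma>"
  using gain_group_closed[of F v] by (auto simp: local_gains_def)

lemma local_gains_mono: "X \<subseteq> Y \<Longrightarrow> local_gains \<Gamma> G \<psi> X v \<subseteq> local_gains \<Gamma> G \<psi> Y v"
  using gain_group_mono[of X Y v] by (auto simp: local_gains_def endverts_def)

lemma gain_group_isolated:
  assumes "v \<notin> endverts G F"
  shows "gain_group \<Gamma> G \<psi> F v = {\<one>\<^bsub>\<Gamma>\<^esub>}"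
proof -
  have "walk_in G F v p v \<longleftrightarrow> p = []" for p
    using assms by (auto dest: walk_in_endverts)
  then show ?thesis by (simp add: gain_group_def)
qed

text \<open>Only at an isolated vertex do the two sets of gains differ, and there the identity is
  all that is missing. Generating sets can thus be built from local gains.\<close>

lemma gain_group_eq_insert:
  "F \<subseteq> arcs G \<Longrightarrow> gain_group \<Gamma> G \<psi> F v = insert \<one>\<^bsub>\<Gamma>\<^esub> (local_gains \<Gamma> G \<psi> F v)"
  using one_in_gain_group[of F v] by (auto simp: local_gains_def gain_group_isolated)

lemma local_gains_insert_other:
  assumes "x \<notin> vertex_component G F (tail G e)" "x \<notin> vertex_component G F (head G e)"
  shows "local_gains \<Gamma> G \<psi> (insert e F) x = local_gains \<Gamma> G \<psi> F x"
proof -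
  have "x \<noteq> tail G e" "x \<noteq> head G e"
    using assms vertex_component_refl by metis+
  then have "x \<in> endverts G (insert e F) \<longleftrightarrow> x \<in> endverts G F" by (auto simp: endverts_def)
  then show ?thesis
    by (simp add: local_gains_def gain_group_def walk_in_insert_other[OF assms])
qed

text \<open>
  A potential \<open>f\<close> switches the gain \<open>g\<close> of an arc from \<open>x\<close> to \<open>y\<close> to \<open>f x \<cdot> g \<cdot> (f y)\<inverse>\<close>;
  switched gains telescope along walks.
\<close>

lemma walk_gain_potential:
  assumes S: "subgroup S \<Gamma>" and F: "F \<subseteq> arcs G"
    and f: "\<And>x. x \<in> K \<Longrightarrow> f x \<in> carrier \<Gamma>"
    and K: "\<And>a. \<lbrakk>a \<in> F; tail G a \<in> K \<or> head G a \<in> K\<rbrakk> \<Longrightarrow> tail G a \<in> K \<and> head G a \<in> K \<and>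
      f (tail G a) \<otimes>\<^bsub>\<Gamma>\<^esub> \<psi> a \<otimes>\<^bsub>\<Gamma>\<^esub> inv\<^bsub>\<Gamma>\<^esub> f (head G a) \<in> S"
    and "walk_in G F u p v" "u \<in> K"
  shows "v \<in> K \<and> f u \<otimes>\<^bsub>\<Gamma>\<^esub> walk_gain \<Gamma> \<psi> p \<otimes>\<^bsub>\<Gamma>\<^esub> inv\<^bsub>\<Gamma>\<^esub> f v \<in> S"
  using assms(5,6)
proof (induction p arbitrary: u)
  case Nil
  then show ?case using f subgroup.one_closed[OF S] by auto
next
  case (Cons s p)
  let ?w = "step_target G s"
  let ?g = "if snd s then \<psi> (fst s) else inv\<^bsub>\<Gamma>\<^esub> \<psi> (fst s)"
  have s: "fst s \<in> F" "step_source G s = u" and p: "walk_in G F ?w p v"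
    using Cons.prems by auto
  have g: "\<psi> (fst s) \<in> carrier \<Gamma>" "walk_gain \<Gamma> \<psi> p \<in> carrier \<Gamma>"
    using s F gain_in_carrier walk_in_gain_closed[OF p F] by auto
  note Ks = K[OF s(1)]
  have w: "?w \<in> K" and gS: "f u \<otimes>\<^bsub>\<Gamma>\<^esub> ?g \<otimes>\<^bsub>\<Gamma>\<^esub> inv\<^bsub>\<Gamma>\<^esub> f ?w \<in> S"
  proof -
    show "?w \<in> K"
      using Ks s(2) Cons.prems(2) by (auto simp: step_source_def step_target_def split: if_splits)
    show "f u \<otimes>\<^bsub>\<Gamma>\<^esub> ?g \<otimes>\<^bsub>\<Gamma>\<^esub> inv\<^bsub>\<Gamma>\<^esub> f ?w \<in> S"
    proof (cases "snd s")
      case True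
      then show ?thesis using Ks s(2) Cons.prems(2) by (auto simp: step_source_def step_target_def)
    next
      case False
      then have ends: "head G (fst s) = u" "tail G (fst s) = ?w"
        using s(2) by (auto simp: step_source_def step_target_def)
      \<comment> \<open>Traversed backwards, the arc contributes the inverse of its switched
        gain.\<close>
      then have "inv\<^bsub>\<Gamma>\<^esub> (f ?w \<otimes>\<^bsub>\<Gamma>\<^esub> \<psi> (fst s) \<otimes>\<^bsub>\<Gamma>\<^esub> inv\<^bsub>\<Gamma>\<^esub> f u) \<in> S"
        using Ks Cons.prems(2) subgroup.m_inv_closed[OF S] by auto
      then show ?thesis
        using False f[OF Cons.prems(2)] f[OF \<open>?w \<in> K\<close>] g by (simp add: inv_mult_group m_assoc)
    qed
  qed
  have IH: "v \<in> K" "f ?w \<otimes>\<^bsub>\<Gamma>\<^esub> walk_gain \<Gamma> \<psi> p \<otimes>\<^bsub>\<Gamma>\<^esub> inv\<^bsub>\<Gamma>\<^esub> f v \<in> S"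
    using Cons.IH[OF p w] by auto
  have c: "f u \<in> carrier \<Gamma>" "f ?w \<in> carrier \<Gamma>" "f v \<in> carrier \<Gamma>" "?g \<in> carrier \<Gamma>"
    using f Cons.prems(2) w IH g by auto
  \<comment> \<open>The potential at the intermediate vertex \<open>?w\<close> cancels between the
    first step and the rest of the walk.\<close>
  have "(f u \<otimes>\<^bsub>\<Gamma>\<^esub> ?g \<otimes>\<^bsub>\<Gamma>\<^esub> inv\<^bsub>\<Gamma>\<^esub> f ?w) \<otimes>\<^bsub>\<Gamma>\<^esub> (f ?w \<otimes>\<^bsub>\<Gamma>\<^esub> walk_gain \<Gamma> \<psi> p \<otimes>\<^bsub>\<Gamma>\<^esub> inv\<^bsub>\<Gamma>\<^esub> f v) \<in> S"
    using gS IH(2) by (rule subgroup.m_closed[OF S])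
  also have "(f u \<otimes>\<^bsub>\<Gamma>\<^esub> ?g \<otimes>\<^bsub>\<Gamma>\<^esub> inv\<^bsub>\<Gamma>\<^esub> f ?w) \<otimes>\<^bsub>\<Gamma>\<^esub> (f ?w \<otimes>\<^bsub>\<Gamma>\<^esub> walk_gain \<Gamma> \<psi> p \<otimes>\<^bsub>\<Gamma>\<^esub> inv\<^bsub>\<Gamma>\<^esub> f v)
      = f u \<otimes>\<^bsub>\<Gamma>\<^esub> walk_gain \<Gamma> \<psi> (s # p) \<otimes>\<^bsub>\<Gamma>\<^esub> inv\<^bsub>\<Gamma>\<^esub> f v"
    using c g by (simp add: m_assoc inv_solve_left del: if_split) (simp add: m_assoc[symmetric])
  finally show ?case using IH(1) by blast
qed

text \<open>On a closed walk at \<open>u\<close> the switched gains telescope to a conjugate by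
  \<open>f u\<close>, and membership of \<open>f u\<close> in \<open>S\<close> undoes the
  conjugation. Asking for membership instead of \<open>f u = \<one>\<close> allows potentials that
  come from arbitrarily chosen walks.\<close>

lemma gain_group_subset_potential:
  assumes S: "subgroup S \<Gamma>" and F: "F \<subseteq> arcs G"
    and f: "\<And>x. x \<in> K \<Longrightarrow> f x \<in> carrier \<Gamma>"
    and K: "\<And>a. \<lbrakk>a \<in> F; tail G a \<in> K \<or> head G a \<in> K\<rbrakk> \<Longrightarrow> tail G a \<in> K \<and> head G a \<in> K \<and>
      f (tail G a) \<otimes>\<^bsub>\<Gamma>\<^esub> \<psi> a \<otimes>\<^bsub>\<Gamma>\<^esub> inv\<^bsub>\<Gamma>\<^esub> f (head G a) \<in> S"
    and u: "u \<in> K" "f u \<in> S"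
  shows "gain_group \<Gamma> G \<psi> F u \<subseteq> S"
proof
  fix x assume "x \<in> gain_group \<Gamma> G \<psi> F u"
  then obtain p where x: "x = walk_gain \<Gamma> \<psi> p" and p: "walk_in G F u p u"
    by (auto simp: gain_group_def)
  have c: "x \<in> carrier \<Gamma>" "f u \<in> carrier \<Gamma>"
    using x walk_in_gain_closed[OF p F] f[OF u(1)] by auto
  have "f u \<otimes>\<^bsub>\<Gamma>\<^esub> x \<otimes>\<^bsub>\<Gamma>\<^esub> inv\<^bsub>\<Gamma>\<^esub> f u \<in> S"
    using walk_gain_potential[where f = f and K = K, OF S F f K p u(1)] x by blast
  then have "inv\<^bsub>\<Gamma>\<^esub> f u \<otimes>\<^bsub>\<Gamma>\<^esub> (f u \<otimes>\<^bsub>\<Gamma>\<^esub> x \<otimes>\<^bsub>\<Gamma>\<^esub> inv\<^bsub>\<Gamma>\<^esub> f u) \<otimes>\<^bsub>\<Gamma>\<^esub> f u \<in> S"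
    using u(2) subgroup.m_closed[OF S] subgroup.m_inv_closed[OF S] by blast
  also have "inv\<^bsub>\<Gamma>\<^esub> f u \<otimes>\<^bsub>\<Gamma>\<^esub> (f u \<otimes>\<^bsub>\<Gamma>\<^esub> x \<otimes>\<^bsub>\<Gamma>\<^esub> inv\<^bsub>\<Gamma>\<^esub> f u) \<otimes>\<^bsub>\<Gamma>\<^esub> f u = x"
    using c by (simp add: m_assoc) (simp add: m_assoc[symmetric])
  finally show "x \<in> S" .
qed

text \<open>Following \<open>p\<close>, then \<open>a\<close>, then \<open>r\<close> backwards
  closes up at \<open>u\<close>. This controls the switched gain of an old arc when the potential is
  the gain of a walk from \<open>u\<close>.\<close>

lemma walk_gain_triangle:
  assumes F: "F \<subseteq> arcs G" and a: "a \<in> F"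
    and p: "walk_in G F u p (tail G a)" and r: "walk_in G F u r (head G a)"
  shows "walk_gain \<Gamma> \<psi> p \<otimes>\<^bsub>\<Gamma>\<^esub> \<psi> a \<otimes>\<^bsub>\<Gamma>\<^esub> inv\<^bsub>\<Gamma>\<^esub> walk_gain \<Gamma> \<psi> r \<in> gain_group \<Gamma> G \<psi> F u"
proof -
  note a' = walk_in_tail_head[OF a]
  have pa: "walk_in G F u (p @ [(a, True)]) (head G a)"
    using p a' unfolding walk_in_append by blast
  have w: "walk_in G F u ((p @ [(a, True)]) @ rev_walk r) u"
    using pa walk_in_rev[OF r] unfolding walk_in_append[of _ _ _ "p @ _"] by blast
  have "walk_gain \<Gamma> \<psi> ((p @ [(a, True)]) @ rev_walk r)
      = walk_gain \<Gamma> \<psi> p \<otimes>\<^bsub>\<Gamma>\<^esub> \<psi> a \<otimes>\<^bsub>\<Gamma>\<^esub> inv\<^bsub>\<Gamma>\<^esub> walk_gain \<Gamma> \<psi> r"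
    using walk_in_gain_append[OF pa walk_in_rev[OF r] F] walk_in_gain_append[OF p a' F]
      walk_in_gain_rev[OF r F] gain_in_carrier a F by auto
  with closed_walk_gain[OF w] show ?thesis by simp
qed

text \<open>The new generator is the gain of the closed walk that crosses \<open>e\<close> and
  returns along \<open>q\<close>. Gains of walks in \<open>F\<close> from the tail form a potential
  that switches all arcs of the component into the generated group, which bounds the new gain group
  from above.\<close>

lemma local_gains_insert_same_component:
  assumes F: "F \<subseteq> arcs G" and e: "e \<in> arcs G" and q: "walk_in G F (head G e) q (tail G e)"
  shows "local_gains \<Gamma> G \<psi> (insert e F) (tail G e)
    = generate \<Gamma> (insert (\<psi> e \<otimes>\<^bsub>\<Gamma>\<^esub> walk_gain \<Gamma> \<psi> q) (local_gains \<Gamma> G \<psi> F (tail G e)))"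
    (is "_ = generate \<Gamma> (insert ?\<gamma> ?A)")
proof -
  let ?u = "tail G e" and ?S = "generate \<Gamma> (insert ?\<gamma> ?A)"
  have eF: "insert e F \<subseteq> arcs G" using e F by auto
  have pe: "\<psi> e \<in> carrier \<Gamma>" and q_carrier: "walk_gain \<Gamma> \<psi> q \<in> carrier \<Gamma>"
    using gain_in_carrier[OF e] walk_in_gain_closed[OF q F] by auto
  have S: "subgroup ?S \<Gamma>"
    using local_gains_closed[OF F] pe q_carrier by (intro generate_is_subgroup) auto
  have AS: "gain_group \<Gamma> G \<psi> F ?u \<subseteq> ?S"
    using subgroup.one_closed[OF S] by (auto simp: gain_group_eq_insert[OF F] intro: generate.incl)
  have uc: "?u \<in> vertex_component G F (head G e)" using q by (auto simp: vertex_component_def)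
  define t where "t x = (SOME p. walk_in G F ?u p x)" for x
  have t: "walk_in G F ?u (t x) x" if "x \<in> vertex_component G F ?u" for x
    using that unfolding t_def vertex_component_def by (auto intro: someI)
  have "gain_group \<Gamma> G \<psi> (insert e F) ?u \<subseteq> ?S"
  proof (rule gain_group_subset_potential[OF S eF,
        where K = "vertex_component G F ?u" and f = "\<lambda>x. walk_gain \<Gamma> \<psi> (t x)"])
    show "walk_gain \<Gamma> \<psi> (t x) \<in> carrier \<Gamma>" if "x \<in> vertex_component G F ?u" for x
      by (rule walk_in_gain_closed[OF t[OF that] F])
    show "?u \<in> vertex_component G F ?u" by (rule vertex_component_refl)
    show "walk_gain \<Gamma> \<psi> (t ?u) \<in> ?S"
      using AS closed_walk_gain[OF t[OF vertex_component_refl]] by blast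
    fix a assume a: "a \<in> insert e F" "tail G a \<in> vertex_component G F ?u \<or> head G a \<in> vertex_component G F ?u"
    have ta: "tail G a \<in> vertex_component G F ?u" "head G a \<in> vertex_component G F ?u"
      using a uc vertex_component_sym[OF uc] vertex_component_refl[of ?u G F] tail_in_vertex_component_iff[of a F G ?u]
      by auto
    have "walk_gain \<Gamma> \<psi> (t (tail G a)) \<otimes>\<^bsub>\<Gamma>\<^esub> \<psi> a \<otimes>\<^bsub>\<Gamma>\<^esub> inv\<^bsub>\<Gamma>\<^esub> walk_gain \<Gamma> \<psi> (t (head G a)) \<in> ?S"
    proof (cases "a = e")
      case False
      then show ?thesis using a AS walk_gain_triangle[OF F _ t t] ta by blast
    next
      case True
      let ?f = "walk_gain \<Gamma> \<psi> (t ?u)" and ?h = "walk_gain \<Gamma> \<psi> (t (head G e))"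
      have hv: "walk_in G F ?u (t (head G e)) (head G e)" using t ta True by auto
      \<comment> \<open>Completed by \<open>q\<close>, the chosen walk to the head becomes closed,
        so its gain lies in the old gain group.\<close>
      have "walk_in G F ?u (t (head G e) @ q) ?u" using hv q unfolding walk_in_append by blast
      from closed_walk_gain[OF this]
      have hq: "?h \<otimes>\<^bsub>\<Gamma>\<^esub> walk_gain \<Gamma> \<psi> q \<in> ?S"
        using AS walk_in_gain_append[OF hv q F] by auto
      have fS: "?f \<in> ?S" using AS closed_walk_gain[OF t[OF vertex_component_refl]] by blast
      have "?\<gamma> \<in> ?S" by (auto intro: generate.incl)
      \<comment> \<open>The switched gain of \<open>e\<close> is the product of \<open>?f\<close>,
        the new generator and the inverse of this closed gain.\<close>
      then have "?f \<otimes>\<^bsub>\<Gamma>\<^esub> ?\<gamma> \<otimes>\<^bsub>\<Gamma>\<^esub> inv\<^bsub>\<Gamma>\<^esub> (?h \<otimes>\<^bsub>\<Gamma>\<^esub> walk_gain \<Gamma> \<psi> q) \<in> ?S"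
        using fS hq subgroup.m_closed[OF S] subgroup.m_inv_closed[OF S] by blast
      also have "?f \<otimes>\<^bsub>\<Gamma>\<^esub> ?\<gamma> \<otimes>\<^bsub>\<Gamma>\<^esub> inv\<^bsub>\<Gamma>\<^esub> (?h \<otimes>\<^bsub>\<Gamma>\<^esub> walk_gain \<Gamma> \<psi> q) = ?f \<otimes>\<^bsub>\<Gamma>\<^esub> \<psi> e \<otimes>\<^bsub>\<Gamma>\<^esub> inv\<^bsub>\<Gamma>\<^esub> ?h"
      proof -
        have c: "?f \<in> carrier \<Gamma>" "?h \<in> carrier \<Gamma>"
          using walk_in_gain_closed[OF hv F] subgroup.mem_carrier[OF S fS] by auto
        have "walk_gain \<Gamma> \<psi> q \<otimes>\<^bsub>\<Gamma>\<^esub> (inv\<^bsub>\<Gamma>\<^esub> walk_gain \<Gamma> \<psi> q \<otimes>\<^bsub>\<Gamma>\<^esub> inv\<^bsub>\<Gamma>\<^esub> ?h) = inv\<^bsub>\<Gamma>\<^esub> ?h"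
          using c q_carrier by (simp flip: m_assoc)
        then show ?thesis using c q_carrier pe by (simp add: m_assoc inv_mult_group)
      qed
      finally show ?thesis using True by simp
    qed
    with ta show "tail G a \<in> vertex_component G F ?u \<and> head G a \<in> vertex_component G F ?u \<and>
      walk_gain \<Gamma> \<psi> (t (tail G a)) \<otimes>\<^bsub>\<Gamma>\<^esub> \<psi> a \<otimes>\<^bsub>\<Gamma>\<^esub> inv\<^bsub>\<Gamma>\<^esub> walk_gain \<Gamma> \<psi> (t (head G a)) \<in> ?S" by blast
  qed
  moreover have "?S \<subseteq> gain_group \<Gamma> G \<psi> (insert e F) ?u"
  proof (rule generate_subgroup_incl[OF _ gain_group_subgroup[OF eF]])
    have "walk_in G (insert e F) ?u ([(e, True)] @ q) ?u"
      using walk_in_mono[OF q, of "insert e F"] by (auto simp: step_source_def step_target_def)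
    from closed_walk_gain[OF this] have "?\<gamma> \<in> gain_group \<Gamma> G \<psi> (insert e F) ?u" by simp
    moreover have "?A \<subseteq> gain_group \<Gamma> G \<psi> (insert e F) ?u"
      using gain_group_mono[of F "insert e F" ?u] gain_group_eq_insert[OF F, of ?u] by blast
    ultimately show "insert ?\<gamma> ?A \<subseteq> gain_group \<Gamma> G \<psi> (insert e F) ?u" by blast
  qed
  moreover have "?u \<in> endverts G (insert e F)" by (auto simp: endverts_def)
  ultimately show ?thesis by (simp add: local_gains_def)
qed

text \<open>Closed walks at the head are entered through \<open>e\<close>, which conjugates their
  gains by \<open>\<psi> e\<close>. Since \<open>e\<close> becomes a bridge, no further generator
  arises. The identity keeps the generating set nonempty when both ends were isolated, as
  \<open>generate_eq\<close> requires.\<close>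

lemma local_gains_insert_other_component:
  assumes F: "F \<subseteq> arcs G" and e: "e \<in> arcs G"
    and disj: "head G e \<notin> vertex_component G F (tail G e)"
  shows "local_gains \<Gamma> G \<psi> (insert e F) (tail G e)
    = generate \<Gamma> (insert \<one>\<^bsub>\<Gamma>\<^esub> (local_gains \<Gamma> G \<psi> F (tail G e)
        \<union> (\<psi> e <#\<^bsub>\<Gamma>\<^esub> local_gains \<Gamma> G \<psi> F (head G e) #>\<^bsub>\<Gamma>\<^esub> inv\<^bsub>\<Gamma>\<^esub> \<psi> e)))"
    (is "_ = generate \<Gamma> (insert _ (?A \<union> ?B))")
proof -
  let ?u = "tail G e" and ?v = "head G e" and ?S = "generate \<Gamma> (insert \<one>\<^bsub>\<Gamma>\<^esub> (?A \<union> ?B))"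
  let ?Cu = "vertex_component G F ?u" and ?Cv = "vertex_component G F ?v"
  have eF: "insert e F \<subseteq> arcs G" using e F by auto
  have pe: "\<psi> e \<in> carrier \<Gamma>" using gain_in_carrier[OF e] by auto
  have B: "?B = (\<lambda>x. \<psi> e \<otimes>\<^bsub>\<Gamma>\<^esub> x \<otimes>\<^bsub>\<Gamma>\<^esub> inv\<^bsub>\<Gamma>\<^esub> \<psi> e) ` local_gains \<Gamma> G \<psi> F ?v"
    by (auto simp: l_coset_def r_coset_def)
  have S: "subgroup ?S \<Gamma>"
    using local_gains_closed[OF F] pe unfolding B by (intro generate_is_subgroup) (auto simp: subset_iff)
  have AS: "gain_group \<Gamma> G \<psi> F ?u \<subseteq> ?S"
    unfolding gain_group_eq_insert[OF F] by (auto intro: generate.incl)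
  have BS: "\<psi> e \<otimes>\<^bsub>\<Gamma>\<^esub> x \<otimes>\<^bsub>\<Gamma>\<^esub> inv\<^bsub>\<Gamma>\<^esub> \<psi> e \<in> ?S" if "x \<in> gain_group \<Gamma> G \<psi> F ?v" for x
  proof -
    have "x = \<one>\<^bsub>\<Gamma>\<^esub> \<or> \<psi> e \<otimes>\<^bsub>\<Gamma>\<^esub> x \<otimes>\<^bsub>\<Gamma>\<^esub> inv\<^bsub>\<Gamma>\<^esub> \<psi> e \<in> ?B"
      using that unfolding gain_group_eq_insert[OF F] B by blast
    then show ?thesis using pe subgroup.one_closed[OF S] by (auto intro: generate.incl)
  qed
  \<comment> \<open>Disjointness of the two components makes the cases of the potential
    \<open>f\<close> below exclusive.\<close>
  have CC: "x \<notin> ?Cv" if "x \<in> ?Cu" for x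
    using that disj vertex_component_sym vertex_component_trans by metis
  define t where "t x = (SOME p. walk_in G F ?u p x)" for x
  have t: "walk_in G F ?u (t x) x" if "x \<in> ?Cu" for x
    using that unfolding t_def vertex_component_def by (auto intro: someI)
  define r where "r x = (SOME p. walk_in G F ?v p x)" for x
  have r: "walk_in G F ?v (r x) x" if "x \<in> ?Cv" for x
    using that unfolding r_def vertex_component_def by (auto intro: someI)
  \<comment> \<open>Vertices on the far side are reached from the tail by crossing \<open>e\<close>
    first, hence the factor \<open>\<psi> e\<close>.\<close>
  define f where
    "f x = (if x \<in> ?Cu then walk_gain \<Gamma> \<psi> (t x) else \<psi> e \<otimes>\<^bsub>\<Gamma>\<^esub> walk_gain \<Gamma> \<psi> (r x))" for x
  note refl = vertex_component_refl[of ?u G F] vertex_component_refl[of ?v G F]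
  have fv: "f x = \<psi> e \<otimes>\<^bsub>\<Gamma>\<^esub> walk_gain \<Gamma> \<psi> (r x)" if "x \<in> ?Cv" for x
    using CC that by (auto simp: f_def)
  have fu: "f ?u \<in> gain_group \<Gamma> G \<psi> F ?u"
    using closed_walk_gain[OF t[OF refl(1)]] refl by (simp add: f_def)
  have "gain_group \<Gamma> G \<psi> (insert e F) ?u \<subseteq> ?S"
  proof (rule gain_group_subset_potential[OF S eF, where K = "?Cu \<union> ?Cv" and f = f])
    show "f x \<in> carrier \<Gamma>" if "x \<in> ?Cu \<union> ?Cv" for x
      using that walk_in_gain_closed[OF t F] walk_in_gain_closed[OF r F] pe by (auto simp: f_def)
    show "?u \<in> ?Cu \<union> ?Cv" using refl by blast
    show "f ?u \<in> ?S" using fu AS by blast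
    fix a assume a: "a \<in> insert e F" "tail G a \<in> ?Cu \<union> ?Cv \<or> head G a \<in> ?Cu \<union> ?Cv"
    consider "a = e" | "a \<in> F" "tail G a \<in> ?Cu" "head G a \<in> ?Cu"
      | "a \<in> F" "tail G a \<in> ?Cv" "head G a \<in> ?Cv"
      using a tail_in_vertex_component_iff[of a F G] by blast
    then show "tail G a \<in> ?Cu \<union> ?Cv \<and> head G a \<in> ?Cu \<union> ?Cv \<and>
      f (tail G a) \<otimes>\<^bsub>\<Gamma>\<^esub> \<psi> a \<otimes>\<^bsub>\<Gamma>\<^esub> inv\<^bsub>\<Gamma>\<^esub> f (head G a) \<in> ?S"
    proof cases
      case 1
      let ?x = "walk_gain \<Gamma> \<psi> (r ?v)"
      have x: "?x \<in> gain_group \<Gamma> G \<psi> F ?v" by (rule closed_walk_gain[OF r[OF refl(2)]])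
      have c: "?x \<in> carrier \<Gamma>" "f ?u \<in> carrier \<Gamma>"
        using x fu gain_group_closed[OF F] by auto
      \<comment> \<open>The walk chosen from the head to itself may be nonempty, so the switched
        gain of \<open>e\<close> is \<open>f ?u\<close> times the inverse of a conjugated old
        gain.\<close>
      have "f ?u \<otimes>\<^bsub>\<Gamma>\<^esub> inv\<^bsub>\<Gamma>\<^esub> (\<psi> e \<otimes>\<^bsub>\<Gamma>\<^esub> ?x \<otimes>\<^bsub>\<Gamma>\<^esub> inv\<^bsub>\<Gamma>\<^esub> \<psi> e) \<in> ?S"
        using fu AS BS[OF x] subgroup.m_closed[OF S] subgroup.m_inv_closed[OF S] by blast
      also have "f ?u \<otimes>\<^bsub>\<Gamma>\<^esub> inv\<^bsub>\<Gamma>\<^esub> (\<psi> e \<otimes>\<^bsub>\<Gamma>\<^esub> ?x \<otimes>\<^bsub>\<Gamma>\<^esub> inv\<^bsub>\<Gamma>\<^esub> \<psi> e) = f ?u \<otimes>\<^bsub>\<Gamma>\<^esub> \<psi> e \<otimes>\<^bsub>\<Gamma>\<^esub> inv\<^bsub>\<Gamma>\<^esub> f ?v"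
        using c pe fv[OF refl(2)] by (simp add: m_assoc inv_mult_group)
      finally show ?thesis using refl 1 by auto
    next
      case 2
      then show ?thesis using AS walk_gain_triangle[OF F 2(1) t t] by (auto simp: f_def)
    next
      case 3
      let ?y = "walk_gain \<Gamma> \<psi> (r (tail G a))" and ?z = "walk_gain \<Gamma> \<psi> (r (head G a))"
      have c: "?y \<in> carrier \<Gamma>" "?z \<in> carrier \<Gamma>" "\<psi> a \<in> carrier \<Gamma>"
        using walk_in_gain_closed[OF r F] 3 gain_in_carrier F by auto
      \<comment> \<open>Both potentials carry the factor \<open>\<psi> e\<close>, so the switched
        gain is the conjugate of an old gain at the head.\<close>
      have "\<psi> e \<otimes>\<^bsub>\<Gamma>\<^esub> (?y \<otimes>\<^bsub>\<Gamma>\<^esub> \<psi> a \<otimes>\<^bsub>\<Gamma>\<^esub> inv\<^bsub>\<Gamma>\<^esub> ?z) \<otimes>\<^bsub>\<Gamma>\<^esub> inv\<^bsub>\<Gamma>\<^esub> \<psi> e \<in> ?S"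
        by (rule BS[OF walk_gain_triangle[OF F 3(1) r[OF 3(2)] r[OF 3(3)]]])
      also have "\<psi> e \<otimes>\<^bsub>\<Gamma>\<^esub> (?y \<otimes>\<^bsub>\<Gamma>\<^esub> \<psi> a \<otimes>\<^bsub>\<Gamma>\<^esub> inv\<^bsub>\<Gamma>\<^esub> ?z) \<otimes>\<^bsub>\<Gamma>\<^esub> inv\<^bsub>\<Gamma>\<^esub> \<psi> e
          = f (tail G a) \<otimes>\<^bsub>\<Gamma>\<^esub> \<psi> a \<otimes>\<^bsub>\<Gamma>\<^esub> inv\<^bsub>\<Gamma>\<^esub> f (head G a)"
        using c pe fv 3 by (simp add: m_assoc inv_mult_group)
      finally show ?thesis using 3 by blast
    qed
  qed
  moreover have "?S \<subseteq> gain_group \<Gamma> G \<psi> (insert e F) ?u"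
  proof (rule generate_subgroup_incl[OF _ gain_group_subgroup[OF eF]])
    have "?B \<subseteq> gain_group \<Gamma> G \<psi> (insert e F) ?u"
    proof
      fix y assume "y \<in> ?B"
      then obtain x where y: "y = \<psi> e \<otimes>\<^bsub>\<Gamma>\<^esub> x \<otimes>\<^bsub>\<Gamma>\<^esub> inv\<^bsub>\<Gamma>\<^esub> \<psi> e"
        and "x \<in> gain_group \<Gamma> G \<psi> F ?v"
        unfolding B gain_group_eq_insert[OF F] by blast
      moreover have "gain_group \<Gamma> G \<psi> F ?v \<subseteq> gain_group \<Gamma> G \<psi> (insert e F) ?v"
        by (rule gain_group_mono) blast
      ultimately show "y \<in> gain_group \<Gamma> G \<psi> (insert e F) ?u"
        using gain_group_conjugate[OF eF walk_in_tail_head[of e "insert e F" G]] pe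
        by (auto simp: l_coset_def r_coset_def)
    qed
    then show "insert \<one>\<^bsub>\<Gamma>\<^esub> (?A \<union> ?B) \<subseteq> gain_group \<Gamma> G \<psi> (insert e F) ?u"
      using gain_group_mono[of F "insert e F" ?u] gain_group_eq_insert[OF F, of ?u] by blast
  qed
  moreover have "?u \<in> endverts G (insert e F)" by (auto simp: endverts_def)
  ultimately show ?thesis by (simp add: local_gains_def)
qed

end

section \<open>Marginal ranks\<close>

locale bounded_gain_graph = symmetric_polymatroidal \<Gamma> \<mu> + gain_graph \<Gamma> G \<psi>
  for \<Gamma> :: "('g, 'm) monoid_scheme" (structure)
    and \<mu> :: "'g set \<Rightarrow> real"
    and G :: "('a, 'b) pre_digraph"
    and \<psi> :: "'b \<Rightarrow> 'g" +
  assumes le_one: "X \<subseteq> carrier \<Gamma> \<Longrightarrow> \<mu> X \<le> 1"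
begin

abbreviation gain_value :: "'b set \<Rightarrow> 'a \<Rightarrow> real" where
  "gain_value F v \<equiv> \<mu> (local_gains \<Gamma> G \<psi> F v)"

abbreviation rank :: "'b set \<Rightarrow> real" where
  "rank F \<equiv> gain_rank \<Gamma> \<mu> G \<psi> F"

section \<open>Values and deficits of components\<close>

lemma gain_value_mono:
  "\<lbrakk>X \<subseteq> Y; Y \<subseteq> arcs G\<rbrakk> \<Longrightarrow> gain_value X v \<le> gain_value Y v"
  by (intro monotone local_gains_mono local_gains_closed)

lemma gain_value_le_one: "F \<subseteq> arcs G \<Longrightarrow> gain_value F v \<le> 1"
  by (intro le_one local_gains_closed)

text \<open>The empty set, left out by \<open>conjugate_eq\<close> but present at isolated vertices,
  is its own conjugate.\<close>

lemma conjugate_value: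
  assumes "X \<subseteq> carrier \<Gamma>" "g \<in> carrier \<Gamma>"
  shows "\<mu> (g <# X #> inv g) = \<mu> X"
  using assms conjugate_eq[of X g] by (cases "X = {}") (auto simp: l_coset_def r_coset_def)

text \<open>Moving the base point along a walk conjugates the gain group; an isolated vertex is
  alone in its component.\<close>

lemma gain_value_vertex_component:
  assumes F: "F \<subseteq> arcs G" and w: "w \<in> vertex_component G F v"
  shows "gain_value F w = gain_value F v"
proof (cases "v \<in> endverts G F")
  case True
  obtain p where p: "walk_in G F v p w" using w by (auto simp: vertex_component_def)
  have "\<mu> (gain_group \<Gamma> G \<psi> F v) = \<mu> (gain_group \<Gamma> G \<psi> F w)"
    unfolding gain_group_conjugate[OF F p]
    by (intro conjugate_value gain_group_closed F walk_in_gain_closed[OF p])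
  then show ?thesis
    using True vertex_component_endverts[OF w] by (simp add: local_gains_def)
next
  case False
  then show ?thesis using w by (simp add: vertex_component_isolated)
qed

text \<open>Attached to vertex sets so that a sum over components counts each of them once. On a
  component the chosen vertex is immaterial, \<open>gain_value\<close> being constant there.\<close>

definition deficit :: "'b set \<Rightarrow> 'a set \<Rightarrow> real" where
  "deficit F K = 1 - gain_value F (SOME v. v \<in> K)"

lemma deficit_eq:
  assumes "F \<subseteq> arcs G" "w \<in> vertex_component G F v"
  shows "deficit F (vertex_component G F v) = 1 - gain_value F w"
proof -
  have "(SOME x. x \<in> vertex_component G F v) \<in> vertex_component G F v"
    using assms(2) by (rule someI)
  then show ?thesis
    using gain_value_vertex_component[OF assms(1)] assms(2) by (simp add: deficit_def)
qed

lemma connected_gain_value_component_arcs: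
  assumes F: "F \<subseteq> arcs G" and v: "v \<in> endverts G F"
  shows "connected_gain_value \<Gamma> \<mu> G \<psi> (component_arcs G F v) = gain_value F v"
proof -
  have "connected_gain_value \<Gamma> \<mu> G \<psi> (component_arcs G F v)
      = \<mu> (gain_group \<Gamma> G \<psi> (component_arcs G F v) v)"
  proof (rule connected_gain_value_eq[OF symmetric_polymatroidal_axioms gain_graph_axioms])
    show "component_arcs G F v \<subseteq> arcs G" using F by (auto simp: component_arcs_def)
    show "v \<in> endverts G (component_arcs G F v)"
      by (simp add: endverts_component_arcs[OF v] vertex_component_refl)
  qed (rule connected_component_arcs[OF v])
  then show ?thesis
    using v by (simp add: local_gains_def gain_group_def walk_in_component_arcs)
qed

text \<open>A component without arcs has deficit \<open>1 - \<mu> {} = 1\<close>, which cancels the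
  vertex it adds to the first term. So the count of vertices can be made independent of
  \<open>F\<close>.\<close>

lemma gain_rank_eq:
  assumes F: "F \<subseteq> arcs G"
  shows "rank F = card (verts G) - (\<Sum>K\<in>vertex_component G F ` verts G. deficit F K)"
proof -
  let ?E = "endverts G F" and ?C = "vertex_component G F"
  have E: "?E \<subseteq> verts G" "finite ?E"
    using endverts_subset[OF F] finite_subset[OF _ finite_verts] by auto
  define \<phi> where "\<phi> K = {a \<in> F. tail G a \<in> K}" for K
  have \<phi>: "\<phi> (?C v) = component_arcs G F v" for v by (simp add: \<phi>_def component_arcs_def)
  have ec: "edge_components G F = \<phi> ` ?C ` ?E"
    by (simp add: edge_components_eq image_image \<phi>)
  \<comment> \<open>Since \<open>endverts\<close> recovers a component from its arcs, edge
    components correspond one to one to the components that have arcs.\<close>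
  have inj: "inj_on \<phi> (?C ` ?E)"
    by (rule inj_on_inverseI[of _ "endverts G"]) (auto simp: \<phi> endverts_component_arcs)
  have "(\<Sum>X\<in>edge_components G F. connected_gain_value \<Gamma> \<mu> G \<psi> X) = (\<Sum>K\<in>?C ` ?E. 1 - deficit F K)"
    unfolding ec sum.reindex[OF inj]
    by (rule sum.cong)
      (auto simp: \<phi> connected_gain_value_component_arcs[OF F] deficit_eq[OF F vertex_component_refl])
  then have rank: "rank F = card ?E - (\<Sum>K\<in>?C ` ?E. deficit F K)"
    by (simp add: gain_rank_def ec card_image[OF inj] sum_subtractf)
  have iso: "?C ` (verts G - ?E) = (\<lambda>v. {v}) ` (verts G - ?E)"
    by (auto simp: vertex_component_isolated intro!: image_eqI)
  have "(\<Sum>K\<in>?C ` (verts G - ?E). deficit F K) = (\<Sum>v\<in>verts G - ?E. 1)"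
    unfolding iso
    by (subst sum.reindex) (auto simp: deficit_def local_gains_def empty intro!: sum.cong)
  moreover have "?C ` ?E \<inter> ?C ` (verts G - ?E) = {}"
    using vertex_component_endverts[of _ G F] vertex_component_refl[of _ G F] by fastforce
  moreover have "?C ` verts G = ?C ` ?E \<union> ?C ` (verts G - ?E)" using E by blast
  ultimately have "(\<Sum>K\<in>?C ` verts G. deficit F K)
      = (\<Sum>K\<in>?C ` ?E. deficit F K) + card (verts G - ?E)"
    using E by (simp add: sum.union_disjoint)
  moreover have "card (verts G) = card ?E + card (verts G - ?E)"
    using E by (simp add: card_Diff_subset card_mono)
  ultimately show ?thesis using rank by simp
qed

text \<open>The components of the two ends are replaced by their union \<open>M\<close>, while those
  in \<open>R\<close> keep their gains and hence their deficits.\<close>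

lemma gain_rank_insert:
  assumes F: "F \<subseteq> arcs G" and e: "e \<in> arcs G"
  shows "rank (insert e F) - rank F =
    (if head G e \<in> vertex_component G F (tail G e)
     then gain_value (insert e F) (tail G e) - gain_value F (tail G e)
     else 1 - gain_value F (tail G e) - gain_value F (head G e) + gain_value (insert e F) (tail G e))"
proof -
  let ?F = "insert e F" and ?V = "verts G" and ?u = "tail G e" and ?v = "head G e"
  let ?C = "vertex_component G F"
  define M where "M = ?C ?u \<union> ?C ?v"
  define R where "R = ?C ` ?V - {?C ?u, ?C ?v}"
  have eF: "?F \<subseteq> arcs G" and uv: "?u \<in> ?V" "?v \<in> ?V" using F e by auto
  note refl = vertex_component_refl[of _ G F]
  have ins: "vertex_component G ?F x = (if x \<in> M then M else ?C x)" for x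
    unfolding M_def by (rule vertex_component_insert)
  have R: "x \<notin> M \<longleftrightarrow> ?C x \<in> R" if "x \<in> ?V" for x
    using that refl vertex_component_eq[of x G F] unfolding R_def M_def by blast
  have "vertex_component G ?F ` ?V = insert M R"
  proof
    show "vertex_component G ?F ` ?V \<subseteq> insert M R" using R by (auto simp: ins)
    show "insert M R \<subseteq> vertex_component G ?F ` ?V"
    proof
      fix K assume "K \<in> insert M R"
      then consider "K = M" | x where "x \<in> ?V" "K = ?C x" "?C x \<in> R" by (auto simp: R_def)
      then show "K \<in> vertex_component G ?F ` ?V"
      proof cases
        case 1
        have "?u \<in> M" using refl by (simp add: M_def)
        then show ?thesis using 1 uv(1) ins[of ?u] by auto
      next
        case 2
        then show ?thesis using R[of x] ins[of x] by auto
      qed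
    qed
  qed
  moreover have "M \<notin> R"
  proof
    assume "M \<in> R"
    then obtain x where x: "x \<in> ?V" "M = ?C x" "?C x \<in> R" by (auto simp: R_def)
    then show False using R[OF x(1)] refl[of x] by auto
  qed
  moreover have "finite R" by (simp add: R_def)
  ultimately have new: "(\<Sum>K\<in>vertex_component G ?F ` ?V. deficit ?F K) = deficit ?F M + (\<Sum>K\<in>R. deficit ?F K)"
    by simp
  have dM: "deficit ?F M = 1 - gain_value ?F ?u"
    using deficit_eq[OF eF vertex_component_refl, of ?u] refl by (simp add: ins M_def)
  have dR: "(\<Sum>K\<in>R. deficit ?F K) = (\<Sum>K\<in>R. deficit F K)"
  proof (rule sum.cong)
    fix K assume K: "K \<in> R"
    then obtain x where x: "x \<in> ?V" "K = ?C x" by (auto simp: R_def)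
    then have xM: "x \<notin> M" using K R by blast
    have "deficit ?F K = 1 - gain_value ?F x"
      using deficit_eq[OF eF vertex_component_refl, of x] xM x(2) by (simp add: ins)
    also have "\<dots> = 1 - gain_value F x"
      using xM by (simp add: M_def local_gains_insert_other)
    also have "\<dots> = deficit F K" using deficit_eq[OF F vertex_component_refl, of x] x(2) by simp
    finally show "deficit ?F K = deficit F K" .
  qed simp
  \<comment> \<open>The set of the two end components has one element exactly if the ends were
    already joined, so one or two old deficits are split off.\<close>
  have "(\<Sum>K\<in>?C ` ?V. deficit F K) = (\<Sum>K\<in>{?C ?u, ?C ?v}. deficit F K) + (\<Sum>K\<in>R. deficit F K)"
    unfolding R_def add.commute[of "sum _ {_, _}"] using uv by (intro sum.subset_diff) auto
  moreover have "?C ?u = ?C ?v \<longleftrightarrow> ?v \<in> ?C ?u"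
    using refl vertex_component_eq by metis
  ultimately show ?thesis
    using new dM dR deficit_eq[OF F vertex_component_refl] gain_value_vertex_component[OF F, of ?v ?u]
    by (auto simp: gain_rank_eq[OF F] gain_rank_eq[OF eF])
qed

text \<open>For an arc between two components the increase is \<open>1\<close> minus the value at
  the head, plus the growth of the value at the tail; both parts are nonnegative.\<close>

lemma gain_rank_insert_ge:
  assumes F: "F \<subseteq> arcs G" and e: "e \<in> arcs G"
  shows "rank F \<le> rank (insert e F)"
proof -
  have "gain_value F (tail G e) \<le> gain_value (insert e F) (tail G e)"
    using F e by (intro gain_value_mono) auto
  then show ?thesis
    using gain_rank_insert[OF F e] gain_value_le_one[OF F, of "head G e"] by (auto split: if_splits)
qed

text \<open>Joined ends stay joined when \<open>X\<close> grows to \<open>Y\<close>, which leaves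
  three cases. Submodularity of \<open>\<mu>\<close> settles those where \<open>e\<close> behaves
  alike for both sets, and the bound \<open>\<mu> \<le> 1\<close> the one where only
  \<open>Y\<close> joins the ends.\<close>

lemma gain_rank_insert_antimono:
  assumes XY: "X \<subseteq> Y" and Y: "Y \<subseteq> arcs G" and e: "e \<in> arcs G"
  shows "rank (insert e Y) - rank Y \<le> rank (insert e X) - rank X"
proof -
  let ?u = "tail G e" and ?v = "head G e"
  have X: "X \<subseteq> arcs G" using XY Y by blast
  have pe: "\<psi> e \<in> carrier \<Gamma>" by (rule gain_in_carrier[OF e])
  let ?A = "\<lambda>F. local_gains \<Gamma> G \<psi> F ?u"
  define B where "B F = \<psi> e <# local_gains \<Gamma> G \<psi> F ?v #> inv (\<psi> e)" for F
  have A: "?A X \<subseteq> ?A Y" "?A X \<subseteq> carrier \<Gamma>" "?A Y \<subseteq> carrier \<Gamma>"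
    using local_gains_mono[OF XY] local_gains_closed X Y by auto
  note mY = gain_rank_insert[OF Y e] and mX = gain_rank_insert[OF X e]
  consider (same) "?v \<in> vertex_component G X ?u"
    | (joined) "?v \<notin> vertex_component G X ?u" "?v \<in> vertex_component G Y ?u"
    | (different) "?v \<notin> vertex_component G Y ?u"
    using vertex_component_mono[OF XY, of G ?u] by blast
  then show ?thesis
  proof cases
    case same
    \<comment> \<open>Taken in the smaller set, the return walk also serves \<open>Y\<close>, so
      both sides acquire the same \<open>\<gamma>\<close>.\<close>
    then obtain q where q: "walk_in G X ?v q ?u"
      using vertex_component_sym by (fastforce simp: vertex_component_def)
    define \<gamma> where "\<gamma> = \<psi> e \<otimes> walk_gain \<Gamma> \<psi> q"
    have \<gamma>: "\<gamma> \<in> carrier \<Gamma>" using pe walk_in_gain_closed[OF q X] by (simp add: \<gamma>_def)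
    have vX: "gain_value (insert e X) ?u = \<mu> (insert \<gamma> (?A X))"
      unfolding local_gains_insert_same_component[OF X e q] \<gamma>_def[symmetric]
      using A \<gamma> by (intro generate_eq[symmetric]) auto
    have vY: "gain_value (insert e Y) ?u = \<mu> (insert \<gamma> (?A Y))"
      unfolding local_gains_insert_same_component[OF Y e walk_in_mono[OF q XY]] \<gamma>_def[symmetric]
      using A \<gamma> by (intro generate_eq[symmetric]) auto
    \<comment> \<open>The enlarged gains for \<open>X\<close> and the old gains for \<open>Y\<close>
      intersect in a set that still contains the old gains for \<open>X\<close>.\<close>
    have "\<mu> (insert \<gamma> (?A X) \<union> ?A Y) + \<mu> (insert \<gamma> (?A X) \<inter> ?A Y) \<le> \<mu> (insert \<gamma> (?A X)) + \<mu> (?A Y)"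
      using A \<gamma> by (intro submodular) auto
    moreover have "insert \<gamma> (?A X) \<union> ?A Y = insert \<gamma> (?A Y)" using A by blast
    moreover have "\<mu> (?A X) \<le> \<mu> (insert \<gamma> (?A X) \<inter> ?A Y)" using A by (intro monotone) auto
    ultimately show ?thesis
      using mX mY same vertex_component_mono[OF XY, of G ?u] vX vY by auto
  next
    case joined
    \<comment> \<open>The increase for \<open>Y\<close> is at most
      \<open>1 - gain_value Y ?u\<close> and that for \<open>X\<close> at least
      \<open>1 - gain_value X ?v\<close>, so these two values are compared.\<close>
    have "gain_value X ?v \<le> gain_value Y ?v" by (rule gain_value_mono[OF XY Y])
    also have "\<dots> = gain_value Y ?u" by (rule gain_value_vertex_component[OF Y joined(2)])
    finally have "gain_value X ?v \<le> gain_value Y ?u" .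
    moreover have "gain_value X ?u \<le> gain_value (insert e X) ?u"
      using X e by (intro gain_value_mono) auto
    moreover have "gain_value (insert e Y) ?u \<le> 1"
      using Y e by (intro gain_value_le_one) auto
    ultimately show ?thesis using mX mY joined by auto
  next
    case different
    then have differentX: "?v \<notin> vertex_component G X ?u" using vertex_component_mono[OF XY, of G ?u] by blast
    have B: "B X \<subseteq> B Y" "B X \<subseteq> carrier \<Gamma>" "B Y \<subseteq> carrier \<Gamma>"
      using local_gains_mono[OF XY, of ?v] local_gains_closed[OF Y, of ?v] pe
      unfolding B_def l_coset_def r_coset_def by (fastforce simp: subset_iff)+
    have valB: "\<mu> (B X) = gain_value X ?v" "\<mu> (B Y) = gain_value Y ?v"
      unfolding B_def by (simp_all add: conjugate_value local_gains_closed X Y pe)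
    have vX: "gain_value (insert e X) ?u = \<mu> (insert \<one> (?A X \<union> B X))"
      unfolding local_gains_insert_other_component[OF X e differentX] B_def[symmetric]
      using A B by (intro generate_eq[symmetric]) auto
    have vY: "gain_value (insert e Y) ?u = \<mu> (insert \<one> (?A Y \<union> B Y))"
      unfolding local_gains_insert_other_component[OF Y e different] B_def[symmetric]
      using A B by (intro generate_eq[symmetric]) auto
    have sub: "\<mu> (insert \<one> (P \<union> Q')) + \<mu> Q \<le> \<mu> (insert \<one> (P \<union> Q)) + \<mu> Q'"
      if "Q \<subseteq> Q'" "P \<subseteq> carrier \<Gamma>" "Q' \<subseteq> carrier \<Gamma>" for P Q Q'
    proof -
      have "\<mu> (insert \<one> (P \<union> Q) \<union> Q') + \<mu> (insert \<one> (P \<union> Q) \<inter> Q') \<le> \<mu> (insert \<one> (P \<union> Q)) + \<mu> Q'"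
        using that by (intro submodular) auto
      moreover have "\<mu> Q \<le> \<mu> (insert \<one> (P \<union> Q) \<inter> Q')" using that by (intro monotone) auto
      moreover have "insert \<one> (P \<union> Q) \<union> Q' = insert \<one> (P \<union> Q')" using that(1) by blast
      ultimately show ?thesis by simp
    qed
    \<comment> \<open>The passage from \<open>X\<close> to \<open>Y\<close> is split: first the
      gains at the tail grow, then those at the head.\<close>
    have "\<mu> (insert \<one> (?A Y \<union> B X)) + \<mu> (?A X) \<le> \<mu> (insert \<one> (?A X \<union> B X)) + \<mu> (?A Y)"
      using sub[OF A(1) B(2) A(3)] by (simp add: Un_commute)
    moreover have "\<mu> (insert \<one> (?A Y \<union> B Y)) + \<mu> (B X) \<le> \<mu> (insert \<one> (?A Y \<union> B X)) + \<mu> (B Y)"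
      by (rule sub[OF B(1) A(3) B(3)])
    ultimately show ?thesis using mX mY different differentX vX vY valB by simp
  qed
qed

section \<open>From single arcs to sets of arcs\<close>

lemma gain_rank_Un_ge:
  assumes "finite Z" "X \<subseteq> arcs G" "Z \<subseteq> arcs G"
  shows "rank X \<le> rank (X \<union> Z)"
  using assms(1,3)
proof (induction rule: finite_induct)
  case (insert e Z)
  then show ?case using gain_rank_insert_ge[of "X \<union> Z" e] assms(2) by simp
qed simp

text \<open>The increments telescope as the arcs of \<open>Z\<close> are added one at a time to both
  sets, and the inclusion between the two sets persists.\<close>

lemma gain_rank_Un_antimono:
  assumes "finite Z" "X \<subseteq> Y" "Y \<subseteq> arcs G" "Z \<subseteq> arcs G"
  shows "rank (Y \<union> Z) - rank Y \<le> rank (X \<union> Z) - rank X"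
  using assms(1,4)
proof (induction rule: finite_induct)
  case (insert e Z)
  have "rank (insert e (Y \<union> Z)) - rank (Y \<union> Z) \<le> rank (insert e (X \<union> Z)) - rank (X \<union> Z)"
    using insert.prems assms(2,3) by (intro gain_rank_insert_antimono) auto
  then show ?case using insert by simp
qed simp

end

theorem theorem4p1:
  fixes \<Gamma> :: "('g, 'm) monoid_scheme"
    and \<mu> :: "'g set \<Rightarrow> real"
    and G :: "('a, 'b) pre_digraph"
    and \<psi> :: "'b \<Rightarrow> 'g"
  assumes "group \<Gamma>"
    and "symmetric_polymatroidal \<Gamma> \<mu>"
    and "\<forall>X. X \<subseteq> carrier \<Gamma> \<longrightarrow> \<mu> X \<in> {0..1}"
    and "gain_graph \<Gamma> G \<psi>"
  shows "(\<forall>X Y. X \<subseteq> Y \<and> Y \<subseteq> arcs G \<longrightarrow>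
            gain_rank \<Gamma> \<mu> G \<psi> X \<le> gain_rank \<Gamma> \<mu> G \<psi> Y)
       \<and> (\<forall>X Y. X \<subseteq> arcs G \<and> Y \<subseteq> arcs G \<longrightarrow>
            gain_rank \<Gamma> \<mu> G \<psi> (X \<union> Y) + gain_rank \<Gamma> \<mu> G \<psi> (X \<inter> Y)
              \<le> gain_rank \<Gamma> \<mu> G \<psi> X + gain_rank \<Gamma> \<mu> G \<psi> Y)"
proof -
  interpret symmetric_polymatroidal \<Gamma> \<mu> by fact
  interpret gain_graph \<Gamma> G \<psi> by fact
  interpret bounded_gain_graph \<Gamma> \<mu> G \<psi>
    by unfold_locales (use assms(3) in auto)
  have fin: "finite Z" if "Z \<subseteq> arcs G" for Z
    using that finite_arcs finite_subset by blast
  show ?thesis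
  proof (intro conjI allI impI)
    fix X Y assume "X \<subseteq> Y \<and> Y \<subseteq> arcs G"
    then show "rank X \<le> rank Y"
      using gain_rank_Un_ge[of Y X] fin[of Y] by (auto simp: Un_absorb1)
  next
    fix X Y assume "X \<subseteq> arcs G \<and> Y \<subseteq> arcs G"
    \<comment> \<open>Submodularity compares the effect of adding \<open>X\<close> to
      \<open>Y\<close> with that of adding it to \<open>X \<inter> Y\<close>.\<close>
    then have "rank (Y \<union> X) - rank Y \<le> rank ((X \<inter> Y) \<union> X) - rank (X \<inter> Y)"
      using fin by (intro gain_rank_Un_antimono) auto
    then show "rank (X \<union> Y) + rank (X \<inter> Y) \<le> rank X + rank Y"
      by (simp add: Un_commute Un_absorb1)
  qed
qed

end
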